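(* Let $S=\{s_1,\ldots,s_k\}\subset\mathbb{R}$ ($k\ge 1$) be a set of servers and let $c:S\to\mathbb{N}$ be an arbitrary capacity. Then the online algorithm PTCP $\mathcal{A}^*$ (defined in the context) is $(2\alpha(S)+1)$-competitive for $\mathrm{OFAL}(S,c)$, i.e. $\mathcal{A}^*(\sigma|S)\le(2\alpha(S)+1)\,\mathrm{Opt}(\sigma|S)$ for every request sequence $\sigma$.
   Context: Online facility assignment on a line $\mathrm{OFAL}(S,c)$: $S=\{s_1,\ldots,s_k\}$ is a finite set of servers placed at distinct points of $\mathbb{R}$ (servers are identified with their positions, $s_1<\cdots<s_k$), and $c:S\to\mathbb{N}$ gives each server a capacity $c(s)\ge 1$. A request sequence $\sigma=r_1\cdots r_n$ of points of $\mathbb{R}$ with $n\le\sum_{s\in S}c(s)$ is revealed one request at a time. A server is free if the number of requests matched with it so far is less than its capacity. When $r_i$ arrives, an online algorithm must irrevocably match $r_i$ with a free server $s$, incurring cost $|r_i-s|$. $\mathcal{A}(\sigma|S)$ is the total cost of algorithm $\mathcal{A}$ on $\sigma$; $\mathrm{Opt}(\sigma|S)$ is the minimum total cost of any capacity-respecting assignment of the requests of $\sigma$ to servers (offline). An algorithm is $\beta$-competitive if $\mathcal{A}(\sigma|S)\le\beta\,\mathrm{Opt}(\sigma|S)$ for every request sequence $\sigma$. For $T=\{t_1<\cdots<t_m\}\subseteq S$ with $m\ge2$ let $L(T)=\frac{t_m-t_1}{\max_{1\le u\le m-1}(t_{u+1}-t_u)}$, and $L(T)=0$ if $|T|\le1$;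 let $\alpha(S)=\max_{T\subseteq S}L(T)$. PTCP: for a server set $S=\{s_1<\cdots<s_k\}$ and nonempty set $F\subseteq S$ of currently free servers, $\mathcal{A}^*[S](r,F)$ is the server with which a request at $r$ is matched, defined recursively. If $F=\{s\}$, output $s$. Otherwise fix an index $a$ with $s_{a+1}-s_a=\max_u(s_{u+1}-s_u)$, let $S_1=\{s_1,\ldots,s_a\}$, $S_2=\{s_{a+1},\ldots,s_k\}$, $\Delta_1=s_a-s_1$, $\Delta_2=s_k-s_{a+1}$, $D=s_{a+1}-s_a$, $x=\frac{\Delta_2+D}{(\Delta_1+D)+(\Delta_2+D)}D$. If ($r\le s_a+x$ and $F\cap S_1\neq\emptyset$) or $F\cap S_2=\emptyset$, output $\mathcal{A}^*[S_1](r,F\cap S_1)$; otherwise (i.e. $s_a+x<r$ and $F\cap S_2\ne\emptyset$, or $F\cap S_1=\emptyset$) output $\mathcal{A}^*[S_2](r,F\cap S_2)$. The online algorithm $\mathcal{A}^*$ for $\mathrm{OFAL}(S,c)$ matches each arriving request $r$ with $\mathcal{A}^*[S](r,F)$, where $F$ is the current set of free servers. *)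

theory Defs
  imports Complex_Main
begin

text \<open>
  Servers are identified with their positions on the real line.  The \<open>i\<close>-th server of a finite
  set, \<open>1 \<le> i \<le> card S\<close>, is counted from the left, starting at 1.
\<close>

definition srv :: "real set \<Rightarrow> nat \<Rightarrow> real" where
  "srv S i = sorted_list_of_set S ! (i - 1)"

definition gap :: "real set \<Rightarrow> nat \<Rightarrow> real" where
  "gap S u = srv S (u + 1) - srv S u"

definition max_gap :: "real set \<Rightarrow> real" where
  "max_gap S = Max (gap S ` {1..card S - 1})"

definition stretch :: "real set \<Rightarrow> real" where
  "stretch T = (if card T \<le> 1 then 0 else (srv T (card T) - srv T 1) / max_gap T)"

definition alpha :: "real set \<Rightarrow> real" where
  "alpha S = Max (stretch ` Pow S)"


text \<open>
  An assignment made so far is a list of pairs (request, server), oldest first.  An online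
  algorithm maps this history and the next request to a server.
\<close>

type_synonym history = "(real \<times> real) list"
type_synonym algorithm = "history \<Rightarrow> real \<Rightarrow> real"

definition free :: "real set \<Rightarrow> (real \<Rightarrow> nat) \<Rightarrow> history \<Rightarrow> real set" where
  "free S c h = {s \<in> S. count_list (map snd h) s < c s}"

fun run :: "algorithm \<Rightarrow> history \<Rightarrow> real list \<Rightarrow> history" where
  "run A h [] = h"
| "run A h (r # rs) = run A (h @ [(r, A h r)]) rs"

definition match_cost :: "history \<Rightarrow> real" where
  "match_cost h = (\<Sum>(r, s)\<leftarrow>h. \<bar>r - s\<bar>)"

definition alg_cost :: "algorithm \<Rightarrow> real list \<Rightarrow> real" where
  "alg_cost A \<sigma> = match_cost (run A [] \<sigma>)"

definition assignments :: "real set \<Rightarrow> (real \<Rightarrow> nat) \<Rightarrow> real list \<Rightarrow> real list set" where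
  "assignments S c \<sigma> =
     {ts. length ts = length \<sigma> \<and> set ts \<subseteq> S \<and> (\<forall>s\<in>S. count_list ts s \<le> c s)}"

definition opt :: "real set \<Rightarrow> (real \<Rightarrow> nat) \<Rightarrow> real list \<Rightarrow> real" where
  "opt S c \<sigma> = Min ((\<lambda>ts. match_cost (zip \<sigma> ts)) ` assignments S c \<sigma>)"

definition competitive :: "real set \<Rightarrow> (real \<Rightarrow> nat) \<Rightarrow> algorithm \<Rightarrow> real \<Rightarrow> bool" where
  "competitive S c A \<beta> \<longleftrightarrow>
     (\<forall>\<sigma>. length \<sigma> \<le> (\<Sum>s\<in>S. c s) \<longrightarrow> alg_cost A \<sigma> \<le> \<beta> * opt S c \<sigma>)"


text \<open>
  PTCP cuts a server set at one of its largest gaps.  Ties are resolved by a function \<open>ix\<close>,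
  which gives the index of the server to the left of the chosen gap.
\<close>

definition max_gap_choice :: "(real set \<Rightarrow> nat) \<Rightarrow> bool" where
  "max_gap_choice ix \<longleftrightarrow>
     (\<forall>T. finite T \<and> card T \<ge> 2 \<longrightarrow> ix T \<in> {1..card T - 1} \<and> gap T (ix T) = max_gap T)"

definition threshold :: "real set \<Rightarrow> nat \<Rightarrow> real" where
  "threshold S a =
     (let \<Delta>\<^sub>1 = srv S a - srv S 1;
          \<Delta>\<^sub>2 = srv S (card S) - srv S (a + 1);
          D = gap S a
      in srv S a + (\<Delta>\<^sub>2 + D) / ((\<Delta>\<^sub>1 + D) + (\<Delta>\<^sub>2 + D)) * D)"

text \<open>
  The recursion is meant for \<open>\<emptyset> \<noteq> F \<subseteq> S\<close> with \<open>S\<close> finite; both parts are then proper subsets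
  of \<open>S\<close>.  Being tail recursive, the equation needs no termination argument to be consistent.
\<close>

partial_function (tailrec) ptcp ::
    "(real set \<Rightarrow> nat) \<Rightarrow> real set \<Rightarrow> real \<Rightarrow> real set \<Rightarrow> real" where
  "ptcp ix S r F =
     (if is_singleton F then the_elem F
      else
        let a = ix S;
            S\<^sub>1 = srv S ` {1..a};
            S\<^sub>2 = srv S ` {a + 1..card S}
        in if (r \<le> threshold S a \<and> F \<inter> S\<^sub>1 \<noteq> {}) \<or> F \<inter> S\<^sub>2 = {}
           then ptcp ix S\<^sub>1 r (F \<inter> S\<^sub>1)
           else ptcp ix S\<^sub>2 r (F \<inter> S\<^sub>2))"

definition ptcp_alg :: "(real set \<Rightarrow> nat) \<Rightarrow> real set \<Rightarrow> (real \<Rightarrow> nat) \<Rightarrow> algorithm" where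
  "ptcp_alg ix S c h r = ptcp ix S r (free S c h)"

lemma finite_assignments:
  assumes "finite S"
  shows "finite (assignments S c \<sigma>)"
  by (rule finite_subset[OF _ finite_lists_length_eq[OF assms, of "length \<sigma>"]])
     (auto simp: assignments_def)

lemma assignments_nonempty:
  assumes "finite S" and "length \<sigma> \<le> (\<Sum>s\<in>S. c s)"
  shows "assignments S c \<sigma> \<noteq> {}"
proof -
  have "\<exists>ts. length ts = n \<and> set ts \<subseteq> S \<and> (\<forall>s\<in>S. count_list ts s \<le> c s)"
    if "n \<le> (\<Sum>s\<in>S. c s)" for n
    using that
  proof (induction n)
    case 0
    show ?case by (rule exI[of _ "[]"]) simp
  next
    case (Suc n)
    then obtain ts where ts: "length ts = n" "set ts \<subseteq> S" "\<forall>s\<in>S. count_list ts s \<le> c s"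
      by auto
    have "(\<Sum>s\<in>S. count_list ts s) = n"
      using sum_count_set[OF ts(2) assms(1)] ts(1) by simp
    then have "\<not> (\<forall>s\<in>S. c s \<le> count_list ts s)"
      using sum_mono[of S c "count_list ts"] Suc.prems by force
    then obtain s where "s \<in> S" "count_list ts s < c s"
      by (auto simp: not_le)
    with ts show ?case
      by (intro exI[of _ "s # ts"]) auto
  qed
  from this[OF assms(2)] show ?thesis
    by (auto simp: assignments_def)
qed

lemma srv_image:
  assumes "finite S"
  shows "srv S ` {1..card S} = S"
proof -
  have "srv S ` {1..card S} = (!) (sorted_list_of_set S) ` {..<card S}"
    unfolding srv_def
    by (force simp: image_iff Bex_def intro: exI[of _ "Suc _"])
  also have "\<dots> = set (sorted_list_of_set S)"
    by (auto simp: set_conv_nth)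
  finally show ?thesis using assms by simp
qed

text \<open>PTCP only uses free servers.\<close>

lemma ptcp_in:
  assumes ix: "max_gap_choice ix" and "finite S" "F \<subseteq> S" "F \<noteq> {}"
  shows "ptcp ix S r F \<in> F"
  using assms(2-)
proof (induction "card S" arbitrary: S F rule: less_induct)
  case less
  show ?case
  proof (cases "is_singleton F")
    case True
    then show ?thesis
      by (subst ptcp.simps) (auto simp: is_singleton_def)
  next
    case False
    define a where "a = ix S"
    define A where "A = srv S ` {1..a}"
    define B where "B = srv S ` {a + 1..card S}"
    have "card F \<noteq> 0" "card F \<noteq> 1"
      using less.prems False finite_subset[of F S] by (auto simp: is_singleton_altdef)
    moreover have "card F \<le> card S"
      using less.prems by (simp add: card_mono)
    ultimately have a: "1 \<le> a" "a < card S"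
      using ix less.prems(1) unfolding max_gap_choice_def a_def by fastforce+
    have "{1..a} \<union> {a + 1..card S} = {1..card S}"
      using a by auto
    then have AB: "A \<union> B = S"
      using srv_image[OF less.prems(1)]
      unfolding A_def B_def image_Un[symmetric] by simp
    have fin: "finite A" "finite B"
      by (auto simp: A_def B_def)
    have "card A \<le> a" "card B \<le> card S - a"
      using card_image_le[of "{1..a}" "srv S"] card_image_le[of "{a + 1..card S}" "srv S"]
      by (auto simp: A_def B_def)
    then have lt: "card A < card S" "card B < card S"
      using a by auto
    have "ptcp ix A r (F \<inter> A) \<in> F \<inter> A" if "F \<inter> A \<noteq> {}"
      using less.hyps[OF lt(1) fin(1) _ that] by simp
    moreover have "ptcp ix B r (F \<inter> B) \<in> F \<inter> B" if "F \<inter> B \<noteq> {}"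
      using less.hyps[OF lt(2) fin(2) _ that] by simp
    moreover have "F \<inter> A \<noteq> {} \<or> F \<inter> B \<noteq> {}"
      using AB less.prems by auto
    moreover have "ptcp ix S r F =
        (if (r \<le> threshold S a \<and> F \<inter> A \<noteq> {}) \<or> F \<inter> B = {}
         then ptcp ix A r (F \<inter> A) else ptcp ix B r (F \<inter> B))"
      using False by (subst ptcp.simps) (simp only: Let_def a_def A_def B_def if_False)
    ultimately show ?thesis
      by (auto split: if_splits)
  qed
qed

end

(* An amortised comparison with an arbitrary assignment, in particular an optimal one.  The servers
   used by the two sides are matched by pairs (y, x), where y is used by PTCP and x by the other
   side.  If the recursive cuts first separate y and x at a cut with x on its left, the pair has
   potential y - x + 2 R, where R bounds how far the discrepancy y can still be pushed to the right
   before it crosses the cut.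

   Let PTCP answer q by s while the other side uses a, and consider the cut that separates s and a.
   If q lies on the side of s, the threshold is far enough from a for 2 alpha |q - a| to pay for
   the new pair (s, a).  Otherwise the part containing a is full, and so is everything between it
   and s; some pair (y, x) then has y in this full block and x outside, and replacing it by (s, x)
   lowers the potential by at least |y - s|. *)

theory Submission
  imports Defs "HOL-Library.Multiset"
begin

section \<open>Trees of cuts\<close>

text \<open>The cuts and thresholds of PTCP depend on the server set alone, so they can be fixed in
  advance as a tree on which proofs go by structural induction.\<close>

datatype cut_tree = Leaf real | Cut cut_tree real cut_tree

fun els :: "cut_tree \<Rightarrow> real set" where
  "els (Leaf a) = {a}"
| "els (Cut l t r) = els l \<union> els r"

fun subtrees :: "cut_tree \<Rightarrow> cut_tree set" where
  "subtrees (Leaf a) = {Leaf a}"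
| "subtrees (Cut l t r) = {Cut l t r} \<union> subtrees l \<union> subtrees r"

fun lo :: "cut_tree \<Rightarrow> real" where
  "lo (Leaf a) = a"
| "lo (Cut l t r) = lo l"

fun hi :: "cut_tree \<Rightarrow> real" where
  "hi (Leaf a) = a"
| "hi (Cut l t r) = hi r"

text \<open>Seen from the threshold, the far end of either part is at most \<open>\<alpha>\<close>
  times as distant as the near end of the other part. The amortised analysis knows largest gaps and
  the threshold formula only through this.\<close>

fun good :: "real \<Rightarrow> cut_tree \<Rightarrow> bool" where
  "good \<alpha> (Leaf a) \<longleftrightarrow> True"
| "good \<alpha> (Cut l t r) \<longleftrightarrow> good \<alpha> l \<and> good \<alpha> r \<and> hi l < lo r \<and> hi l \<le> t \<and> t \<le> lo r \<and>
     hi r - t \<le> \<alpha> * (t - hi l) \<and> t - lo l \<le> \<alpha> * (lo r - t)"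

text \<open>Ties at a threshold may be broken either way, which makes the relation invariant under
  reflection of the line.\<close>

fun chosen :: "cut_tree \<Rightarrow> real \<Rightarrow> real set \<Rightarrow> real \<Rightarrow> bool" where
  "chosen (Leaf a) q F s \<longleftrightarrow> s = a \<and> a \<in> F"
| "chosen (Cut l t r) q F s \<longleftrightarrow>
     chosen l q F s \<and> (q \<le> t \<or> F \<inter> els r = {}) \<or> chosen r q F s \<and> (t \<le> q \<or> F \<inter> els l = {})"

lemma lo_in_els: "lo t \<in> els t"
  by (induction t) auto

lemma hi_in_els: "hi t \<in> els t"
  by (induction t) auto

lemma els_bounds:
  assumes "good \<alpha> t" "y \<in> els t"
  shows "lo t \<le> y" "y \<le> hi t"
proof -
  have "\<forall>y\<in>els t. lo t \<le> y \<and> y \<le> hi t"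
    using assms(1)
  proof (induction t)
    case (Cut l t r)
    have "lo l \<le> hi l" "lo r \<le> hi r"
      using Cut lo_in_els[of l] lo_in_els[of r] by auto
    then show ?case
      using Cut by force
  qed auto
  then show "lo t \<le> y" "y \<le> hi t"
    using assms(2) by auto
qed

lemma lo_le_hi: "good \<alpha> t \<Longrightarrow> lo t \<le> hi t"
  using els_bounds hi_in_els by blast

lemma els_Cut_less:
  assumes "good \<alpha> (Cut l t r)" "y \<in> els l" "z \<in> els r"
  shows "y < z"
  using els_bounds(2)[of \<alpha> l y] els_bounds(1)[of \<alpha> r z] assms by auto

lemma els_Cut_disjoint:
  assumes "good \<alpha> (Cut l t r)"
  shows "y \<in> els r \<Longrightarrow> y \<notin> els l" "y \<in> els l \<Longrightarrow> y \<notin> els r"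
  using els_Cut_less[OF assms] by fastforce+

lemma subtrees_els: "Q \<in> subtrees t \<Longrightarrow> els Q \<subseteq> els t"
  by (induction t) auto

lemma chosen_in: "chosen t q F s \<Longrightarrow> s \<in> F \<and> s \<in> els t"
  by (induction t) auto

text \<open>A request at or beyond the right end lies to the right of every threshold, so each cut
  sends it right as long as the right part has a free server.\<close>

lemma chosen_rightmost:
  assumes "good \<alpha> t" "chosen t q F s" "hi t \<le> q" "z \<in> F" "z \<in> els t"
  shows "z \<le> s"
  using assms
proof (induction t)
  case (Cut l t r)
  have q: "t \<le> q" "hi l \<le> q" "hi r \<le> q" "good \<alpha> l" "good \<alpha> r"
    using Cut.prems lo_le_hi[of \<alpha> r] by auto
  show ?case
  proof (cases "chosen r q F s")
    case True
    then have "s \<in> els r"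
      using chosen_in by blast
    then show ?thesis
      using Cut.IH(2) q True Cut.prems els_Cut_less[OF Cut.prems(1), of z s] by auto
  next
    case False
    have "F \<inter> els r = {}"
    proof (rule ccontr)
      assume "F \<inter> els r \<noteq> {}"
      with False Cut.prems(2) have "q \<le> t"
        by auto
      \<comment> \<open>Strictness excludes a tie at \<open>t\<close>. If \<open>t = lo r\<close>,
        the last inequality of \<open>good\<close> would give
        \<open>lo r \<le> lo l\<close>.\<close>
      moreover have "t < lo r"
        using Cut.prems(1) lo_le_hi[of \<alpha> l] by (cases "t = lo r") auto
      ultimately show False
        using q lo_le_hi[of \<alpha> r] by auto
    qed
    then show ?thesis
      using Cut.IH(1) q False Cut.prems by auto
  qed
qed auto

text \<open>PTCP stops when one free server is left, whereas \<open>chosen\<close> always descends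
  to a leaf; this reconciles the two.\<close>

lemma chosen_singleton: "s \<in> els t \<Longrightarrow> good \<alpha> t \<Longrightarrow> chosen t q {s} s"
proof (induction t)
  case (Cut l t r)
  then show ?case
    using els_Cut_disjoint[OF Cut.prems(2)] by auto
qed auto

text \<open>PTCP restricts the free set in each recursive call, whereas \<open>chosen\<close> passes
  it on unchanged.\<close>

lemma chosen_Int: "els t \<subseteq> A \<Longrightarrow> chosen t q (F \<inter> A) s = chosen t q F s"
proof (induction t)
  case (Cut l t r)
  moreover have "F \<inter> A \<inter> els l = F \<inter> els l" "F \<inter> A \<inter> els r = F \<inter> els r"
    using Cut.prems by auto
  ultimately show ?case by simp
qed auto

section \<open>The potential of a displaced server\<close>

text \<open>Suppose that the server \<open>y\<close> is taken and that later requests shift this discrepancy through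
  the tree.  It leaves a subtree only when that subtree has no free server left, so it moves in
  depth-first order, and it sweeps every newly entered subtree monotonically.  The two functions
  bound the total length of its moves to the right and to the left, respectively.\<close>

fun right_moves :: "cut_tree \<Rightarrow> real \<Rightarrow> real set \<Rightarrow> real"
  and left_moves :: "cut_tree \<Rightarrow> real \<Rightarrow> real set \<Rightarrow> real" where
  "right_moves (Leaf a) y F = 0"
| "right_moves (Cut l t r) y F =
     (if y \<in> els l
      then if F \<inter> els r = {} then right_moves l y F else hi r - y + left_moves l y F
      else right_moves r y F)"
| "left_moves (Leaf a) y F = 0"
| "left_moves (Cut l t r) y F =
     (if y \<in> els l then left_moves l y F
      else if F \<inter> els l = {} then left_moves r y F else y - lo l + right_moves r y F)"

text \<open>The algorithm has used \<open>y\<close> and the reference assignment has used \<open>x\<close> instead.\<close>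

fun pot :: "cut_tree \<Rightarrow> real set \<Rightarrow> real \<Rightarrow> real \<Rightarrow> real" where
  "pot (Leaf a) F y x = 0"
| "pot (Cut l t r) F y x =
     (if y \<in> els l
      then if x \<in> els l then pot l F y x else x - y + 2 * left_moves l y F
      else if x \<in> els l then y - x + 2 * right_moves r y F else pot r F y x)"

text \<open>The last two claims say that the net displacement stays inside the tree:
  \<open>y + right_moves t y F - left_moves t y F\<close> lies between \<open>lo t\<close> and
  \<open>hi t\<close>.\<close>

lemma moves_bounds:
  assumes "good \<alpha> t" "y \<in> els t"
  shows "0 \<le> right_moves t y F" "0 \<le> left_moves t y F"
    "right_moves t y F \<le> hi t - y + left_moves t y F"
    "left_moves t y F \<le> y - lo t + right_moves t y F"
proof -
  have "0 \<le> right_moves t y F \<and> 0 \<le> left_moves t y F \<and>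
    right_moves t y F \<le> hi t - y + left_moves t y F \<and>
    left_moves t y F \<le> y - lo t + right_moves t y F"
    using assms
  proof (induction t)
    case (Cut l t r)
    then show ?case
      using lo_le_hi[of \<alpha> l] lo_le_hi[of \<alpha> r] els_bounds[OF Cut.prems]
      by (cases "y \<in> els l") auto
  qed auto
  then show "0 \<le> right_moves t y F" "0 \<le> left_moves t y F"
    "right_moves t y F \<le> hi t - y + left_moves t y F"
    "left_moves t y F \<le> y - lo t + right_moves t y F"
    by auto
qed

text \<open>The critical case is a part that loses its last free server, where the other branch of
  the definition applies; \<open>moves_bounds\<close> compares the two branches.\<close>

lemma moves_mono:
  assumes "good \<alpha> t" "y \<in> els t" "F' \<subseteq> F"
  shows "right_moves t y F' \<le> right_moves t y F \<and> left_moves t y F' \<le> left_moves t y F"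
  using assms
proof (induction t)
  case (Cut l t r)
  have le: "hi l \<le> hi r" "lo l \<le> lo r"
    using Cut.prems lo_le_hi[of \<alpha> l] lo_le_hi[of \<alpha> r] by auto
  have sub: "F \<inter> els l = {} \<Longrightarrow> F' \<inter> els l = {}" "F \<inter> els r = {} \<Longrightarrow> F' \<inter> els r = {}"
    using Cut.prems by auto
  show ?case
  proof (cases "y \<in> els l")
    case True
    then show ?thesis
      using Cut sub le moves_bounds(3)[of \<alpha> l y F] by auto
  next
    case False
    then show ?thesis
      using Cut sub le moves_bounds(4)[of \<alpha> r y F] by auto
  qed
qed auto

lemma right_moves_rightmost:
  assumes "good \<alpha> t" "y \<in> els t" "\<forall>z\<in>F \<inter> els t. z \<le> y"
  shows "right_moves t y F = 0"
  using assms
proof (induction t)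
  case (Cut l t r)
  have IH: "y \<in> els l \<Longrightarrow> right_moves l y F = 0" "y \<in> els r \<Longrightarrow> right_moves r y F = 0"
    using Cut by (simp_all add: Int_Un_distrib ball_Un)
  show ?case
  proof (cases "y \<in> els l")
    case True
    have "z \<notin> F \<inter> els r" for z
      using els_Cut_less[OF Cut.prems(1) True, of z] Cut.prems(3) by force
    then have "F \<inter> els r = {}"
      by blast
    then show ?thesis
      using True IH by simp
  next
    case False
    then show ?thesis
      using Cut.prems IH by simp
  qed
qed simp

lemma pot_ge_dist:
  assumes "good \<alpha> t" "y \<in> els t" "x \<in> els t"
  shows "\<bar>y - x\<bar> \<le> pot t F y x"
  using assms
proof (induction t)
  case (Cut l t r)
  have g: "good \<alpha> l" "good \<alpha> r"
    using Cut.prems by auto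
  note less = els_Cut_less[OF Cut.prems(1)]
  show ?case
  proof (cases "y \<in> els l")
    case True
    then show ?thesis
      using Cut g less[of y x] moves_bounds(2)[OF g(1) True, of F] by auto
  next
    case False
    then have "y \<in> els r"
      using Cut.prems by auto
    then show ?thesis
      using Cut g False less[of x y] moves_bounds(1)[OF g(2), of y F] by auto
  qed
qed auto

lemma pot_mono:
  assumes "good \<alpha> t" "y \<in> els t" "x \<in> els t" "F' \<subseteq> F"
  shows "pot t F' y x \<le> pot t F y x"
  using assms
proof (induction t)
  case (Cut l t r)
  have g: "good \<alpha> l" "good \<alpha> r"
    using Cut.prems by auto
  show ?case
    using Cut moves_mono[OF g(2), of y F' F] moves_mono[OF g(1), of y F' F]
    by auto
qed auto

lemma pot_self: "good \<alpha> t \<Longrightarrow> pot t F y y = 0"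
  by (induction t) auto

lemma pot_rightmost:
  assumes "good \<alpha> t" "s \<in> els t" "x \<in> els t" "x \<le> s" "\<forall>z\<in>F \<inter> els t. z \<le> s"
  shows "pot t F s x = s - x"
  using assms
proof (induction t)
  case (Cut l t r)
  then show ?case
    using els_Cut_less[OF Cut.prems(1), of s x] right_moves_rightmost[of \<alpha> r s F] by auto
qed auto

lemma pot_subtree:
  assumes "good \<alpha> t" "Q \<in> subtrees t" "y \<in> els Q" "x \<in> els Q"
  shows "pot t F y x = pot Q F y x"
  using assms
proof (induction t)
  case (Cut l t r)
  then show ?case
    using subtrees_els[of Q l] subtrees_els[of Q r] els_Cut_disjoint[OF Cut.prems(1)] 
    by (auto dest: subsetD)
qed auto

lemma good_subtree: "good \<alpha> t \<Longrightarrow> Q \<in> subtrees t \<Longrightarrow> good \<alpha> Q"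
  by (induction t) auto

lemma self_subtree: "t \<in> subtrees t"
  by (cases t) auto

text \<open>At the cut separating \<open>s\<close> from \<open>y\<close>, the free server
  \<open>s\<close> makes \<open>left_moves\<close> charge \<open>y\<close> for a sweep to the left
  end. The way from \<open>y\<close> to \<open>s\<close> is part of that sweep.\<close>

lemma moves_shift_left:
  assumes "good \<alpha> t" "Q \<in> subtrees t" "s \<in> els Q" "y \<in> els Q" "s < y" "s \<in> F" "F' \<subseteq> F"
    "\<forall>z\<in>F \<inter> els Q. z \<le> s"
  shows "right_moves t s F' \<le> right_moves t y F \<and>
    left_moves t s F' + (y - s) \<le> left_moves t y F"
  using assms
proof (induction t arbitrary: Q)
  case (Cut l t r)
  have g: "good \<alpha> l" "good \<alpha> r" "hi l < lo r"
    using Cut.prems by auto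
  have le: "hi l \<le> hi r" "lo l \<le> lo r"
    using g lo_le_hi[of \<alpha> l] lo_le_hi[of \<alpha> r] by auto
  have sub: "F \<inter> els l = {} \<Longrightarrow> F' \<inter> els l = {}" "F \<inter> els r = {} \<Longrightarrow> F' \<inter> els r = {}"
    using Cut.prems by auto
  note dis = els_Cut_disjoint[OF Cut.prems(1)] and less = els_Cut_less[OF Cut.prems(1)]
  have Qt: "els Q \<subseteq> els l \<union> els r"
    using subtrees_els[OF Cut.prems(2)] by simp
  consider (L) "s \<in> els l" "y \<in> els l" | (R) "s \<in> els r" "y \<in> els r" | (X) "s \<in> els l" "y \<in> els r"
    using Cut.prems(3-5) less[of y s] Qt by (auto dest: subsetD)
  then show ?case
  proof cases
    case L
    obtain Q' where "Q' \<in> subtrees l" "s \<in> els Q'" "y \<in> els Q'" "\<forall>z\<in>F \<inter> els Q'. z \<le> s"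
    proof (cases "Q = Cut l t r")
      case True
      then show ?thesis using that[OF self_subtree[of l]] L Cut.prems by auto
    next
      case False
      then show ?thesis using that[of Q] L Cut.prems subtrees_els[of Q r] dis by auto
    qed
    then have "right_moves l s F' \<le> right_moves l y F \<and>
        left_moves l s F' + (y - s) \<le> left_moves l y F"
      using Cut.IH(1) g Cut.prems by blast
    then show ?thesis
      using L sub moves_bounds(3)[OF g(1) L(2), of F] le by auto
  next
    case R
    obtain Q' where "Q' \<in> subtrees r" "s \<in> els Q'" "y \<in> els Q'" "\<forall>z\<in>F \<inter> els Q'. z \<le> s"
    proof (cases "Q = Cut l t r")
      case True
      then show ?thesis using that[OF self_subtree[of r]] R Cut.prems by auto
    next
      case False
      then show ?thesis using that[of Q] R Cut.prems subtrees_els[of Q l] dis by auto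
    qed
    then have IH: "right_moves r s F' \<le> right_moves r y F \<and>
        left_moves r s F' + (y - s) \<le> left_moves r y F"
      using Cut.IH(2) g Cut.prems by blast
    \<comment> \<open>This covers the case that \<open>l\<close> has a free server in
      \<open>F\<close> but none in \<open>F'\<close>.\<close>
    have "left_moves r s F' \<le> s - lo r + right_moves r s F'"
      using moves_bounds(4)[OF g(2) R(1)] .
    then show ?thesis
      using R dis sub IH le by auto
  next
    case X
    then have "Q = Cut l t r"
      using Cut.prems(2-4) subtrees_els[of Q l] subtrees_els[of Q r] dis by (auto dest: subsetD)
    then have Fr: "F \<inter> els r = {}" and z: "\<forall>z\<in>F \<inter> els l. z \<le> s"
      using Cut.prems(8) less[OF X(1)] by (force simp: Int_Un_distrib ball_Un)+
    \<comment> \<open>Hence \<open>left_moves l s F'\<close> is at most \<open>s - lo l\<close>,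
      whereas \<open>y\<close> is charged at least \<open>y - lo l\<close>.\<close>
    have "right_moves l s F' = 0"
      using right_moves_rightmost[OF g(1) X(1)] z Cut.prems by auto
    then show ?thesis
      using X dis(1)[OF X(2)] Fr sub moves_bounds(4)[OF g(1) X(1), of F'] moves_bounds(1)[OF g(2) X(2), of F] Cut.prems
      by auto
  qed
qed auto

text \<open>The factor 2 in \<open>pot\<close> is used here. If \<open>x\<close> is cut off to the
  right, moving \<open>y\<close> to \<open>s\<close> lengthens the pair by \<open>y - s\<close> and
  another \<open>y - s\<close> is to be gained; \<open>left_moves\<close> drops by
  \<open>y - s\<close> and counts twice. If \<open>x\<close> is cut off to the left, the pair itself
  gets shorter by \<open>y - s\<close>.\<close>

lemma pot_shift_left:
  assumes "good \<alpha> t" "Q \<in> subtrees t" "s \<in> els Q" "y \<in> els Q" "s < y" "s \<in> F" "F' \<subseteq> F"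
    "\<forall>z\<in>F \<inter> els Q. z \<le> s" "x \<in> els t" "x \<in> els Q \<Longrightarrow> x \<le> s"
  shows "pot t F' s x + (y - s) \<le> pot t F y x"
proof (cases "x \<in> els Q")
  case True
  have Q: "good \<alpha> Q"
    using assms good_subtree by blast
  have "pot t F' s x = s - x"
    using pot_rightmost[OF Q, of s x F'] pot_subtree[of \<alpha> t Q s x F'] assms True by auto
  then show ?thesis
    using pot_ge_dist[OF Q, of y x F] pot_subtree[of \<alpha> t Q y x F] assms True by auto
next
  case False
  show ?thesis
    using assms False
  proof (induction t)
    case (Cut l t r)
    have g: "good \<alpha> l" "good \<alpha> r"
      using Cut.prems by auto
    note dis = els_Cut_disjoint[OF Cut.prems(1)]
    have "Q \<noteq> Cut l t r"
      using Cut.prems by auto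
    then consider (L) "Q \<in> subtrees l" | (R) "Q \<in> subtrees r"
      using Cut.prems by auto
    then show ?case
    proof cases
      case L
      then have "s \<in> els l" "y \<in> els l"
        using subtrees_els[of Q l] Cut.prems by auto
      then show ?thesis
        using Cut L g moves_shift_left[OF g(1) L, of s y F F'] by auto
    next
      case R
      then have "s \<in> els r" "y \<in> els r"
        using subtrees_els[of Q r] Cut.prems by auto
      then show ?thesis
        using Cut R g dis moves_shift_left[OF g(2) R, of s y F F'] by auto
    qed
  qed auto
qed

section \<open>Paying for a choice\<close>

text \<open>The sum of the two inequalities of \<open>good\<close>, in which \<open>t\<close>
  cancels.\<close>

lemma gap_stretch:
  assumes "good \<alpha> (Cut l t r)"
  shows "hi r - lo l \<le> \<alpha> * (lo r - hi l)"
  using assms by (auto simp: algebra_simps)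

text \<open>Only a cut with \<open>s\<close> on its left and free servers on its right adds a sweep.
  Such a cut has \<open>q \<le> t\<close>, and \<open>good\<close> then bounds the extra width by
  \<open>\<alpha>\<close> times a distance to the right of \<open>q\<close>.\<close>

lemma chosen_right_moves:
  assumes "0 \<le> \<alpha>" "good \<alpha> t" "chosen t q F s" "q \<le> hi t"
  shows "right_moves t s F \<le> hi t - max s q + \<alpha> * (hi t - q)"
  using assms
proof (induction t)
  case (Cut l t r)
  have g: "good \<alpha> l" "good \<alpha> r" "hi l < lo r" "hi l \<le> t" "t \<le> lo r"
    "t - lo l \<le> \<alpha> * (lo r - t)"
    using Cut.prems by auto
  have le: "lo l \<le> hi l" "lo r \<le> hi r"
    using g lo_le_hi by auto
  note dis = els_Cut_disjoint[OF Cut.prems(2)] and less = els_Cut_less[OF Cut.prems(2)]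
  note mult = mult_left_mono[OF _ Cut.prems(1)]
  show ?case
  proof (cases "chosen r q F s")
    case True
    then show ?thesis
      using Cut dis chosen_in[OF True] by auto
  next
    case False
    then have l: "chosen l q F s" and qt: "q \<le> t \<or> F \<inter> els r = {}"
      using Cut.prems by auto
    have s: "s \<in> els l" "s \<le> hi l"
      using chosen_in[OF l] els_bounds[OF g(1)] by auto
    have far: "right_moves l s F = 0" if "hi l < q"
      using right_moves_rightmost[OF g(1) s(1)] chosen_rightmost[OF g(1) l] that by auto
    have near: "right_moves l s F \<le> hi l - max s q + \<alpha> * (hi l - q)" if "q \<le> hi l"
      using Cut.IH(1) Cut.prems g l that by auto
    show ?thesis
    proof (cases "F \<inter> els r = {}")
      case True
      have "0 \<le> \<alpha> * (hi r - q)"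
        using Cut.prems by auto
      then show ?thesis
        using True s far near mult[of "hi l - q" "hi r - q"] Cut.prems g le
        by (cases "q \<le> hi l") auto
    next
      case False
      then have qt: "q \<le> t"
        using qt by simp
      have eq: "right_moves (Cut l t r) s F \<le> hi r - lo l + right_moves l s F"
        using False s moves_bounds(4)[OF g(1) s(1), of F] by auto
      show ?thesis
      proof (cases "q \<le> hi l")
        case True
        \<comment> \<open>Together with the term \<open>\<alpha> * (hi l - q)\<close> of
          \<open>near\<close>, the right side telescopes to
          \<open>\<alpha> * (hi r - q)\<close>.\<close>
        have "hi l - lo l \<le> \<alpha> * (hi r - hi l)"
          using gap_stretch[OF Cut.prems(2)] mult[of "lo r - hi l" "hi r - hi l"] g le by auto
        then show ?thesis
          using eq near[OF True] by (auto simp: algebra_simps)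
      next
        case False
        have "q - lo l \<le> \<alpha> * (hi r - q)"
          using qt g le mult[of "lo r - t" "hi r - q"] by auto
        then show ?thesis
          using eq far False s by auto
      qed
    qed
  qed
qed auto

text \<open>As \<open>q \<le> o'\<close>, the left side equals
  \<open>2 * (max q s - s + left_moves l s F) + (o' - q)\<close>, so it suffices to bound the
  bracket by \<open>\<alpha> * (o' - q)\<close>.\<close>

lemma preferred_left_cost:
  assumes "0 \<le> \<alpha>" "good \<alpha> (Cut l t r)" "chosen l q F s" "o' \<in> els r" "q \<le> t"
  shows "\<bar>q - s\<bar> + (o' - s + 2 * left_moves l s F) \<le> (2 * \<alpha> + 1) * \<bar>q - o'\<bar>"
proof -
  have g: "good \<alpha> l" "good \<alpha> r" "hi l < lo r" "hi l \<le> t" "t \<le> lo r"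
    "t - lo l \<le> \<alpha> * (lo r - t)"
    using assms by auto
  have le: "lo l \<le> hi l" "lo r \<le> hi r" "lo r \<le> o'"
    using g lo_le_hi els_bounds[OF g(2)] assms by auto
  have s: "s \<in> els l" "s \<le> hi l"
    using chosen_in[OF assms(3)] els_bounds[OF g(1)] by auto
  note mult = mult_left_mono[OF _ assms(1)]
  have lam: "left_moves l s F \<le> s - lo l + right_moves l s F"
    using moves_bounds(4)[OF g(1) s(1)] .
  have "max q s - s + left_moves l s F \<le> \<alpha> * (o' - q)"
  proof (cases "q \<le> hi l")
    case True
    \<comment> \<open>The distance from \<open>hi l\<close> to \<open>o'\<close> pays for the width
      of \<open>l\<close>; the one from \<open>q\<close> to \<open>hi l\<close> pays for
      \<open>right_moves\<close>.\<close>
    have "hi l - lo l \<le> \<alpha> * (o' - hi l)"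
      using gap_stretch[OF assms(2)] mult[of "lo r - hi l" "o' - hi l"] le g by auto
    then show ?thesis
      using lam chosen_right_moves[OF assms(1) g(1) assms(3) True] by (auto simp: algebra_simps)
  next
    case False
    have "right_moves l s F = 0"
      using right_moves_rightmost[OF g(1) s(1)] chosen_rightmost[OF g(1) assms(3)] False by auto
    \<comment> \<open>Here the position of the threshold in the gap matters:
      \<open>q \<le> t\<close> leaves at least \<open>lo r - t\<close> between \<open>q\<close> and
      \<open>o'\<close>.\<close>
    moreover have "q - lo l \<le> \<alpha> * (o' - q)"
      using mult[of "lo r - t" "o' - q"] le g assms by auto
    ultimately show ?thesis
      using lam False s by auto
  qed
  moreover have "\<bar>q - o'\<bar> = o' - q" "\<bar>q - s\<bar> = 2 * (max q s - s) - (q - s)"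
    using le g assms by auto
  ultimately show ?thesis
    by (simp add: distrib_right)
qed

text \<open>At the cut separating \<open>s\<close> and \<open>o'\<close>, either the request prefers
  the side of \<open>s\<close>, or it was diverted because the right part is full; then
  \<open>s\<close> is the rightmost free server below this cut.\<close>

lemma chosen_alternative_left:
  assumes "0 \<le> \<alpha>" "good \<alpha> t" "chosen t q F s" "o' \<in> els t" "s < o'"
  shows "\<bar>q - s\<bar> + pot t F s o' \<le> (2 * \<alpha> + 1) * \<bar>q - o'\<bar> \<or>
    (\<exists>Q\<in>subtrees t. s \<in> els Q \<and> o' \<in> els Q \<and> (\<forall>z\<in>F \<inter> els Q. z \<le> s))"
  using assms
proof (induction t)
  case (Cut l t r)
  have g: "good \<alpha> l" "good \<alpha> r" "hi l \<le> t"
    using Cut.prems by auto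
  note dis = els_Cut_disjoint[OF Cut.prems(2)] and less = els_Cut_less[OF Cut.prems(2)]
  have "s \<in> els l \<union> els r"
    using chosen_in[OF Cut.prems(3)] by simp
  then consider (L) "s \<in> els l" "o' \<in> els l" | (R) "s \<in> els r" "o' \<in> els r"
    | (X) "s \<in> els l" "o' \<in> els r"
    using Cut.prems(4,5) less[of o' s] by auto
  then show ?case
  proof cases
    case L
    then have "chosen l q F s"
      using Cut.prems dis chosen_in[of r q F s] by auto
    then show ?thesis
      using Cut L g by auto
  next
    case R
    then have "chosen r q F s"
      using Cut.prems dis chosen_in[of l q F s] by auto
    then show ?thesis
      using Cut R g dis by auto
  next
    case X
    then have l: "chosen l q F s"
      using Cut.prems dis chosen_in[of r q F s] by auto
    have "\<not> chosen r q F s"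
      using X dis chosen_in[of r q F s] by auto
    then consider "q \<le> t" | "t < q" "F \<inter> els r = {}"
      using Cut.prems by force
    then show ?thesis
    proof cases
      case 1
      then show ?thesis
        using preferred_left_cost[OF Cut.prems(1,2) l X(2)] X dis by auto
    next
      case 2
      then have "\<forall>z\<in>F \<inter> els (Cut l t r). z \<le> s"
        using chosen_rightmost[OF g(1) l] g by auto
      then show ?thesis
        using X self_subtree[of "Cut l t r"] by (intro disjI2 bexI[of _ "Cut l t r"]) auto
    qed
  qed
qed auto

definition full_block :: "cut_tree \<Rightarrow> real set \<Rightarrow> real \<Rightarrow> real set \<Rightarrow> bool" where
  "full_block t F s Z \<longleftrightarrow> Z \<subseteq> els t \<and> Z \<inter> F = {} \<and>
     (\<forall>y\<in>Z. \<forall>x\<in>els t - Z. \<forall>F'\<subseteq>F. pot t F' s x + \<bar>y - s\<bar> \<le> pot t F y x)"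

text \<open>Either the reference assignment pays for the new discrepancy, or all servers on the way from
  \<open>s\<close> to \<open>o'\<close> are full, and then a discrepancy in this block can be moved to \<open>s\<close>.\<close>

lemma chosen_dichotomy_left:
  assumes "0 \<le> \<alpha>" "good \<alpha> t" "chosen t q F s" "o' \<in> els t" "s < o'"
  shows "\<bar>q - s\<bar> + pot t F s o' \<le> (2 * \<alpha> + 1) * \<bar>q - o'\<bar> \<or>
    (\<exists>Z. full_block t F s Z \<and> o' \<in> Z)"
  using chosen_alternative_left[OF assms]
proof
  assume "\<exists>Q\<in>subtrees t. s \<in> els Q \<and> o' \<in> els Q \<and> (\<forall>z\<in>F \<inter> els Q. z \<le> s)"
  then obtain Q where Q: "Q \<in> subtrees t" "s \<in> els Q" "o' \<in> els Q" "\<forall>z\<in>F \<inter> els Q. z \<le> s"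
    by blast
  \<comment> \<open>By the choice of \<open>Q\<close>, nothing free lies here, and any
    \<open>x\<close> outside meets the side condition of \<open>pot_shift_left\<close>.\<close>
  let ?Z = "{z \<in> els Q. s < z}"
  have s: "s \<in> F"
    using chosen_in[OF assms(3)] ..
  have shift: "pot t F' s x + \<bar>y - s\<bar> \<le> pot t F y x"
    if "y \<in> ?Z" "x \<in> els t - ?Z" "F' \<subseteq> F" for y x F'
  proof -
    have "y \<in> els Q" "s < y" "x \<in> els t" "x \<in> els Q \<Longrightarrow> x \<le> s"
      using that by auto
    then show ?thesis
      using pot_shift_left[OF assms(2) Q(1,2) _ _ s \<open>F' \<subseteq> F\<close> Q(4), of y x] by simp
  qed
  have "z \<notin> F" if "z \<in> ?Z" for z
    using bspec[OF Q(4), of z] that by auto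
  then have "?Z \<inter> F = {}"
    by blast
  moreover have "?Z \<subseteq> els t" "o' \<in> ?Z"
    using Q(3) subtrees_els[OF Q(1)] assms(5) by auto
  ultimately have "full_block t F s ?Z"
    unfolding full_block_def using shift by blast
  then show ?thesis
    using \<open>o' \<in> ?Z\<close> by blast
qed simp

section \<open>Reflection\<close>

fun mirror :: "cut_tree \<Rightarrow> cut_tree" where
  "mirror (Leaf a) = Leaf (- a)"
| "mirror (Cut l t r) = Cut (mirror r) (- t) (mirror l)"

lemma els_mirror: "els (mirror t) = uminus ` els t"
  by (induction t) auto

lemma lo_hi_mirror: "lo (mirror t) = - hi t" "hi (mirror t) = - lo t"
  by (induction t) auto

lemma good_mirror: "good \<alpha> t \<Longrightarrow> good \<alpha> (mirror t)"
  by (induction t) (auto simp: lo_hi_mirror algebra_simps)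

lemma uminus_image_Int_empty:
  "uminus ` A \<inter> uminus ` B = {} \<longleftrightarrow> A \<inter> (B :: real set) = {}"
  by auto

lemma mem_uminus_image: "- y \<in> uminus ` A \<longleftrightarrow> y \<in> (A :: real set)"
  by auto

lemma chosen_mirror:
  "chosen (mirror t) (- q) (uminus ` F) (- s) = chosen t q F s"
  by (induction t) (auto simp: els_mirror uminus_image_Int_empty mem_uminus_image)

text \<open>The definitions test membership in the left part only, so their symmetry rests on
  \<open>y\<close> lying in exactly one of the two parts.\<close>

lemma moves_mirror:
  assumes "good \<alpha> t" "y \<in> els t"
  shows "right_moves (mirror t) (- y) (uminus ` F) = left_moves t y F \<and>
    left_moves (mirror t) (- y) (uminus ` F) = right_moves t y F"
  using assms
proof (induction t)
  case (Cut l t r)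
  then show ?case
    using els_Cut_disjoint[OF Cut.prems(1)]
    by (auto simp: els_mirror uminus_image_Int_empty mem_uminus_image lo_hi_mirror)
qed auto

lemma pot_mirror:
  assumes "good \<alpha> t" "y \<in> els t" "x \<in> els t"
  shows "pot (mirror t) (uminus ` F) (- y) (- x) = pot t F y x"
  using assms
proof (induction t)
  case (Cut l t r)
  then show ?case
    using els_Cut_disjoint[OF Cut.prems(1)] moves_mirror[of \<alpha> l y F] moves_mirror[of \<alpha> r y F]
    by (auto simp: els_mirror mem_uminus_image)
qed auto

lemma chosen_dichotomy:
  assumes "0 \<le> \<alpha>" "good \<alpha> t" "chosen t q F s" "o' \<in> els t"
  shows "\<bar>q - s\<bar> + pot t F s o' \<le> (2 * \<alpha> + 1) * \<bar>q - o'\<bar> \<or>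
    (\<exists>Z. full_block t F s Z \<and> o' \<in> Z)"
proof -
  consider "s < o'" | "s = o'" | "o' < s" by linarith
  then show ?thesis
  proof cases
    case 1
    then show ?thesis using chosen_dichotomy_left assms by blast
  next
    case 2
    have "1 * \<bar>q - s\<bar> \<le> (2 * \<alpha> + 1) * \<bar>q - s\<bar>"
      using assms(1) by (intro mult_right_mono) auto
    then show ?thesis
      using pot_self[OF assms(2)] 2 by simp
  next
    case 3
    have s: "s \<in> els t"
      using chosen_in assms by blast
    have "chosen (mirror t) (- q) (uminus ` F) (- s)" "- o' \<in> els (mirror t)" "- s < - o'"
      using 3 assms by (auto simp: chosen_mirror els_mirror)
    from chosen_dichotomy_left[OF assms(1) good_mirror[OF assms(2)] this]
    show ?thesis
    proof
      assume "\<bar>- q - - s\<bar> + pot (mirror t) (uminus ` F) (- s) (- o')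
          \<le> (2 * \<alpha> + 1) * \<bar>- q - - o'\<bar>"
      then show ?thesis
        using pot_mirror[OF assms(2) s assms(4)] by (simp add: abs_minus_commute)
    next
      assume "\<exists>Z. full_block (mirror t) (uminus ` F) (- s) Z \<and> - o' \<in> Z"
      then obtain Z where fb: "full_block (mirror t) (uminus ` F) (- s) Z" and o': "- o' \<in> Z"
        by blast
      have Z: "Z \<subseteq> els (mirror t)" "Z \<inter> uminus ` F = {}"
        and shift: "\<And>y x F'. y \<in> Z \<Longrightarrow> x \<in> els (mirror t) - Z \<Longrightarrow> F' \<subseteq> uminus ` F \<Longrightarrow>
          pot (mirror t) F' (- s) x + \<bar>y - - s\<bar> \<le> pot (mirror t) (uminus ` F) y x"
        using fb unfolding full_block_def by auto
      let ?Z = "{z. - z \<in> Z}"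
      have "pot t F' s x + \<bar>y - s\<bar> \<le> pot t F y x"
        if "- y \<in> Z" "x \<in> els t" "- x \<notin> Z" "F' \<subseteq> F" for y x F'
      proof -
        have "y \<in> els t"
          using subsetD[OF Z(1) that(1)] by (auto simp: els_mirror)
        moreover have "- x \<in> els (mirror t) - Z"
          using that by (simp add: els_mirror)
        ultimately have "pot t F' s x + \<bar>- y - - s\<bar> \<le> pot t F y x"
          using shift[OF that(1), of "- x" "uminus ` F'"] that(2,4)
            pot_mirror[OF assms(2) s, of x F'] pot_mirror[OF assms(2), of y x F]
          by (simp add: image_mono)
        moreover have "\<bar>- y - - s\<bar> = \<bar>y - s\<bar>"
          by linarith
        ultimately show ?thesis
          by linarith
      qed
      then have "\<forall>y\<in>?Z. \<forall>x\<in>els t - ?Z. \<forall>F'\<subseteq>F. pot t F' s x + \<bar>y - s\<bar> \<le> pot t F y x"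
        by simp
      moreover have "?Z \<subseteq> els t"
        using Z(1) by (auto simp: els_mirror)
      moreover have "?Z \<inter> F = {}"
      proof -
        have "- z \<notin> uminus ` F" if "z \<in> ?Z" for z
          using that Z(2) by blast
        then show ?thesis
          by (auto simp: mem_uminus_image)
      qed
      ultimately have "full_block t F s ?Z"
        unfolding full_block_def by (intro conjI)
      then show ?thesis
        using o' by blast
    qed
  qed
qed

section \<open>Tracking a reference assignment\<close>

text \<open>The pairs of \<open>N\<close> are the arcs of a graph in which no vertex of \<open>Z\<close> has more incoming than
  outgoing arcs.  A walk from \<open>a\<close> can then be continued until it leaves \<open>Z\<close>, by an arc \<open>(y, x)\<close>;
  the whole walk is deleted from \<open>N\<close>.\<close>

lemma walk_out:
  fixes N :: "(real \<times> real) multiset"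
  assumes "a \<in> Z"
    and "count (image_mset snd N) a < count (image_mset fst N) a"
    and "\<And>z. z \<in> Z \<Longrightarrow> count (image_mset snd N) z \<le> count (image_mset fst N) z"
    and "\<And>y x. (y, x) \<in># N \<Longrightarrow> \<bar>y - x\<bar> \<le> f (y, x)"
  shows "\<exists>y x N'. y \<in> Z \<and> x \<notin> Z \<and> add_mset (y, x) N' \<subseteq># N \<and>
    image_mset fst N + image_mset snd N' + {#x#} = image_mset snd N + image_mset fst N' + {#a#} \<and>
    \<Sum>\<^sub># (image_mset f N') + f (y, x) + \<bar>a - y\<bar> \<le> \<Sum>\<^sub># (image_mset f N)"
  using assms
proof (induction "size N" arbitrary: N a rule: less_induct)
  case less
  have "a \<in># image_mset fst N"
    using less.prems(2) by (metis gr_implies_not0 not_in_iff)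
  then obtain x where x: "(a, x) \<in># N"
    by auto
  then obtain M where N: "N = add_mset (a, x) M"
    by (meson mset_add)
  show ?case
  proof (cases "x \<in> Z")
    case False
    then show ?thesis
      using less.prems(1) N by (intro exI[of _ a] exI[of _ x] exI[of _ M]) auto
  next
    case True
    \<comment> \<open>Deleting the arc from \<open>a\<close> to \<open>x\<close> uses up the surplus
      at \<open>a\<close> and creates one at \<open>x\<close>, where the walk resumes.\<close>
    have "count (image_mset snd M) z \<le> count (image_mset fst M) z" if "z \<in> Z" for z
      using less.prems(2) less.prems(3)[OF that] N by (auto split: if_splits)
    moreover have "count (image_mset snd M) x < count (image_mset fst M) x"
      using less.prems(2) less.prems(3)[OF True] N by (auto split: if_splits)
    moreover have "\<bar>y - x\<bar> \<le> f (y, x)" if "(y, x) \<in># M" for y x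
      using less.prems(4) that N by auto
    moreover have "size M < size N"
      using N by simp
    ultimately obtain y x' N' where *: "y \<in> Z" "x' \<notin> Z" "add_mset (y, x') N' \<subseteq># M"
      "image_mset fst M + image_mset snd N' + {#x'#} = image_mset snd M + image_mset fst N' + {#x#}"
      "\<Sum>\<^sub># (image_mset f N') + f (y, x') + \<bar>x - y\<bar> \<le> \<Sum>\<^sub># (image_mset f M)"
      using less.hyps[OF _ True] by blast
    have "add_mset (y, x') N' \<subseteq># N"
      using subset_mset.order_trans[OF *(3), of N] N by simp
    moreover have "image_mset fst N + image_mset snd N' + {#x'#}
        = image_mset snd N + image_mset fst N' + {#a#}"
      using *(4) N by simp
    moreover have "\<Sum>\<^sub># (image_mset f N') + f (y, x') + \<bar>a - y\<bar> \<le> \<Sum>\<^sub># (image_mset f N)"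
      using *(5) less.prems(4)[OF x] N by auto
    ultimately show ?thesis
      using *(1,2) by blast
  qed
qed

text \<open>\<open>A\<close> and \<open>B\<close> are the servers used so far by the algorithm and by the reference assignment.\<close>

definition tracked ::
    "cut_tree \<Rightarrow> real set \<Rightarrow> real multiset \<Rightarrow> real multiset \<Rightarrow> real \<Rightarrow> bool" where
  "tracked t F A B b \<longleftrightarrow>
     (\<exists>N. set_mset N \<subseteq> els t \<times> els t \<and> A + image_mset snd N = B + image_mset fst N \<and>
        (\<Sum>(y, x)\<in>#N. pot t F y x) \<le> b)"

lemma tracked_nonneg:
  assumes "good \<alpha> t" "tracked t F A B b"
  shows "0 \<le> b"
proof -
  obtain N where N: "set_mset N \<subseteq> els t \<times> els t" "(\<Sum>(y, x)\<in>#N. pot t F y x) \<le> b"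
    using assms(2) unfolding tracked_def by blast
  have "0 \<le> pot t F (fst p) (snd p)" if "p \<in># N" for p
    using pot_ge_dist[OF assms(1), of "fst p" "snd p" F] that N(1) by (auto dest: subsetD)
  then have "0 \<le> (\<Sum>(y, x)\<in>#N. pot t F y x)"
    using sum_mset_mono[of N "\<lambda>_. 0" "\<lambda>(y, x). pot t F y x"] by (simp add: case_prod_beta)
  with N(2) show ?thesis by simp
qed

context
  fixes \<alpha> :: real and t :: cut_tree and c :: "real \<Rightarrow> nat" and F :: "real set"
    and A B :: "real multiset" and b a :: real
  assumes good: "good \<alpha> t"
    and tracked: "tracked t F A B b"
    and cap: "\<And>v. v \<in> els t \<Longrightarrow> count B v \<le> c v"
    and full: "\<And>v. v \<in> els t - F \<Longrightarrow> c v \<le> count A v"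
    and a: "a \<in> els t" "count B a < c a"
begin

text \<open>On \<open>Z\<close> the algorithm has used all capacity, so the balance of
  \<open>N\<close> gives every vertex of \<open>Z\<close> at least as many outgoing as incoming
  arcs, and strictly more at \<open>a\<close>, where the reference has capacity left.\<close>

lemma tracked_walk_out:
  assumes "Z \<subseteq> els t" "Z \<inter> F = {}" "a \<in> Z"
  shows "\<exists>y x N'. y \<in> Z \<and> x \<in> els t - Z \<and> set_mset N' \<subseteq> els t \<times> els t \<and>
    A + image_mset snd N' + {#x#} = B + image_mset fst N' + {#a#} \<and>
    (\<Sum>(y, x)\<in>#N'. pot t F y x) + pot t F y x + \<bar>a - y\<bar> \<le> b"
proof -
  obtain N where N: "set_mset N \<subseteq> els t \<times> els t" "A + image_mset snd N = B + image_mset fst N"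
    "(\<Sum>(y, x)\<in>#N. pot t F y x) \<le> b"
    using tracked unfolding tracked_def by blast
  have count: "count A z + count (image_mset snd N) z = count B z + count (image_mset fst N) z" for z
    using N(2) by (metis count_union)
  have "count (image_mset snd N) z \<le> count (image_mset fst N) z" if "z \<in> Z" for z
    using count[of z] cap[of z] full[of z] that assms by force
  moreover have "count (image_mset snd N) a < count (image_mset fst N) a"
    using count[of a] full[of a] a assms by force
  moreover have "\<bar>y - x\<bar> \<le> (\<lambda>(y, x). pot t F y x) (y, x)" if "(y, x) \<in># N" for y x
    using pot_ge_dist[OF good] that N(1) by auto
  ultimately obtain y x N' where *: "y \<in> Z" "x \<notin> Z" "add_mset (y, x) N' \<subseteq># N"
    "image_mset fst N + image_mset snd N' + {#x#} = image_mset snd N + image_mset fst N' + {#a#}"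
    "(\<Sum>(y, x)\<in>#N'. pot t F y x) + pot t F y x + \<bar>a - y\<bar> \<le> (\<Sum>(y, x)\<in>#N. pot t F y x)"
    using walk_out[OF assms(3), of N "\<lambda>(y, x). pot t F y x"] by auto
  have "set_mset (add_mset (y, x) N') \<subseteq> els t \<times> els t"
    using set_mset_mono[OF *(3)] N(1) by blast
  moreover have "A + image_mset snd N' + {#x#} = B + image_mset fst N' + {#a#}"
  proof -
    \<comment> \<open>The two balance equations are added and the common part cancelled, which
      avoids truncated subtraction.\<close>
    have "(A + image_mset snd N' + {#x#}) + (image_mset snd N + image_mset fst N) =
        (A + image_mset snd N) + (image_mset fst N + image_mset snd N' + {#x#})"
      by simp
    also have "\<dots> = (B + image_mset fst N' + {#a#}) + (image_mset snd N + image_mset fst N)"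
      unfolding N(2) *(4) by simp
    finally show ?thesis
      by (rule add_right_imp_eq)
  qed
  ultimately show ?thesis
    using * N(3) by (intro exI[of _ y] exI[of _ x] exI[of _ N']) auto
qed

text \<open>With the whole tree as \<open>Z\<close>, a walk would have to leave the tree.\<close>

lemma tracked_free_nonempty: "F \<inter> els t \<noteq> {}"
proof
  assume "F \<inter> els t = {}"
  then show False
    using tracked_walk_out[of "els t"] a by blast
qed

text \<open>Either the pair \<open>(s, a)\<close> is added at the expense of the reference cost, or
  a walk from \<open>a\<close> through a full block is replaced by one pair starting at
  \<open>s\<close>.\<close>

lemma tracked_step:
  assumes "0 \<le> \<alpha>" "chosen t q F s" "F' \<subseteq> F"
  shows "tracked t F' (add_mset s A) (add_mset a B) (b + (2 * \<alpha> + 1) * \<bar>q - a\<bar> - \<bar>q - s\<bar>)"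
proof -
  have s: "s \<in> els t"
    using chosen_in[OF assms(2)] ..
  have mono: "(\<Sum>(y, x)\<in>#N. pot t F' y x) \<le> (\<Sum>(y, x)\<in>#N. pot t F y x)"
    if "set_mset N \<subseteq> els t \<times> els t" for N
    using that pot_mono[OF good _ _ assms(3)] by (intro sum_mset_mono) auto
  from chosen_dichotomy[OF assms(1) good assms(2) a(1)] show ?thesis
  proof
    assume le: "\<bar>q - s\<bar> + pot t F s a \<le> (2 * \<alpha> + 1) * \<bar>q - a\<bar>"
    obtain N where N: "set_mset N \<subseteq> els t \<times> els t" "A + image_mset snd N = B + image_mset fst N"
      "(\<Sum>(y, x)\<in>#N. pot t F y x) \<le> b"
      using tracked unfolding tracked_def by blast
    then show ?thesis
      unfolding tracked_def using le s a(1) mono[OF N(1)] pot_mono[OF good s a(1) assms(3)]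
      by (intro exI[of _ "add_mset (s, a) N"]) auto
  next
    assume "\<exists>Z. full_block t F s Z \<and> a \<in> Z"
    then obtain Z where Z: "full_block t F s Z" "a \<in> Z"
      by blast
    then obtain y x N where N: "y \<in> Z" "x \<in> els t - Z" "set_mset N \<subseteq> els t \<times> els t"
      "A + image_mset snd N + {#x#} = B + image_mset fst N + {#a#}"
      "(\<Sum>(y, x)\<in>#N. pot t F y x) + pot t F y x + \<bar>a - y\<bar> \<le> b"
      using tracked_walk_out[of Z] unfolding full_block_def by blast
    have "pot t F' s x + \<bar>y - s\<bar> \<le> pot t F y x"
      using Z(1) N(1,2) assms(3) unfolding full_block_def by blast
    moreover have "1 * \<bar>q - a\<bar> \<le> (2 * \<alpha> + 1) * \<bar>q - a\<bar>"
      using assms(1) by (intro mult_right_mono) auto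
    \<comment> \<open>The three terms are paid by the reference cost, by the deleted walk and by the
      potential lost in moving \<open>y\<close> to \<open>s\<close>.\<close>
    moreover have "\<bar>q - s\<bar> \<le> \<bar>q - a\<bar> + \<bar>a - y\<bar> + \<bar>y - s\<bar>"
      by linarith
    ultimately have "pot t F' s x + (\<Sum>(y, x)\<in>#N. pot t F' y x)
        \<le> b + (2 * \<alpha> + 1) * \<bar>q - a\<bar> - \<bar>q - s\<bar>"
      using N(5) mono[OF N(3)] by linarith
    moreover have "add_mset s A + image_mset snd (add_mset (s, x) N)
        = add_mset a B + image_mset fst (add_mset (s, x) N)"
      using N(4) by simp
    moreover have "set_mset (add_mset (s, x) N) \<subseteq> els t \<times> els t"
      using s N(2,3) by simp
    ultimately show ?thesis
      unfolding tracked_def by (intro exI[of _ "add_mset (s, x) N"]) auto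
  qed
qed

end

lemma run_cost_le:
  assumes "0 \<le> \<alpha>" "good \<alpha> t"
    and choice: "\<And>h q. free (els t) c h \<noteq> {} \<Longrightarrow> chosen t q (free (els t) c h) (alg h q)"
    and "length rs = length ts" "set ts \<subseteq> els t"
    and "\<And>v. v \<in> els t \<Longrightarrow> count B v + count_list ts v \<le> c v"
    and "tracked t (free (els t) c h) (mset (map snd h)) B b"
  shows "match_cost (run alg h rs) \<le> match_cost h + b + (2 * \<alpha> + 1) * match_cost (zip rs ts)"
  using assms(4-)
proof (induction rs arbitrary: ts h B b)
  case Nil
  then show ?case
    using tracked_nonneg[OF assms(2) Nil(4)] by (simp add: match_cost_def)
next
  case (Cons q rs)
  then obtain a ts' where ts: "ts = a # ts'"
    by (cases ts) auto
  define F where "F = free (els t) c h"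
  define s where "s = alg h q"
  define h' where "h' = h @ [(q, s)]"
  have tr: "tracked t F (mset (map snd h)) B b"
    using Cons.prems(4) F_def by simp
  have cap: "count B v \<le> c v" if "v \<in> els t" for v
    using Cons.prems(3)[OF that] by simp
  have full: "c v \<le> count (mset (map snd h)) v" if "v \<in> els t - F" for v
    using that by (auto simp: F_def free_def count_mset simp flip: mset_map)
  have a: "a \<in> els t" "count B a < c a"
    using Cons.prems(2) Cons.prems(3)[of a] ts by auto
  have "F \<noteq> {}"
    using tracked_free_nonempty[OF assms(2) tr cap full a] by blast
  then have ch: "chosen t q F s"
    using choice[of h q] by (simp add: F_def s_def)
  have sub: "free (els t) c h' \<subseteq> F"
    by (auto simp: F_def free_def h'_def)
  have "tracked t (free (els t) c h') (mset (map snd h')) (add_mset a B)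
      (b + (2 * \<alpha> + 1) * \<bar>q - a\<bar> - \<bar>q - s\<bar>)"
    using tracked_step[OF assms(2) tr cap full a assms(1) ch sub] by (simp add: h'_def)
  moreover have "count (add_mset a B) v + count_list ts' v \<le> c v" if "v \<in> els t" for v
    using Cons.prems(3)[OF that] ts by (auto split: if_splits)
  ultimately have "match_cost (run alg h' rs)
      \<le> match_cost h' + (b + (2 * \<alpha> + 1) * \<bar>q - a\<bar> - \<bar>q - s\<bar>) + (2 * \<alpha> + 1) * match_cost (zip rs ts')"
    using Cons.IH[of ts' "add_mset a B" h'] Cons.prems(1,2) ts by simp
  then show ?case
    by (simp add: ts h'_def s_def match_cost_def distrib_left)
qed

section \<open>The tree of PTCP\<close>

lemma srv_less:
  assumes "finite S" "1 \<le> i" "i < j" "j \<le> card S"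
  shows "srv S i < srv S j"
  unfolding srv_def using assms
  by (intro sorted_wrt_nth_less[OF strict_sorted_list_of_set]) auto

lemma srv_le:
  assumes "finite S" "1 \<le> i" "i \<le> j" "j \<le> card S"
  shows "srv S i \<le> srv S j"
  using srv_less[OF assms(1,2)] assms by (cases "i = j") (auto intro: less_imp_le)

lemma lo_srv:
  assumes "good \<alpha> t" "els t = srv S ` {i..j}" "finite S" "1 \<le> i" "i \<le> j" "j \<le> card S"
  shows "lo t = srv S i" "hi t = srv S j"
proof -
  have "lo t \<in> srv S ` {i..j}" "hi t \<in> srv S ` {i..j}"
    using lo_in_els[of t] hi_in_els[of t] assms(2) by auto
  then have "srv S i \<le> lo t" "hi t \<le> srv S j"
    using srv_le[OF assms(3)] assms(4-) by auto
  moreover have "srv S i \<in> els t" "srv S j \<in> els t"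
    using assms by auto
  then have "lo t \<le> srv S i" "srv S j \<le> hi t"
    using els_bounds[OF assms(1)] by auto
  ultimately show "lo t = srv S i" "hi t = srv S j"
    by auto
qed

text \<open>With \<open>x = v / (u + v) * d\<close>, the difference \<open>v - x\<close> is the
  fraction \<open>v / (u + v)\<close> of \<open>u + v - d\<close>, just as \<open>x\<close> is of
  \<open>d\<close>. This explains the ratio in the threshold.\<close>

lemma threshold_balance:
  fixes u v d \<alpha> :: real
  assumes "0 < d" "d \<le> u" "d \<le> v" "u + v - d \<le> \<alpha> * d"
  shows "v - v / (u + v) * d \<le> \<alpha> * (v / (u + v) * d)"
proof -
  have "v / (u + v) * (u + v - d) \<le> v / (u + v) * (\<alpha> * d)"
    using assms by (intro mult_left_mono) auto
  moreover have "v / (u + v) * (u + v - d) = v - v / (u + v) * d"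
    using assms by (simp add: right_diff_distrib)
  ultimately show ?thesis
    by (simp add: algebra_simps)
qed

lemma good_Cut:
  assumes "good \<alpha> l" "good \<alpha> r" "finite S" "1 \<le> a" "a < card S"
    and "els l = srv S ` {1..a}" "els r = srv S ` {a + 1..card S}"
    and "srv S (card S) - srv S 1 \<le> \<alpha> * gap S a"
  shows "good \<alpha> (Cut l (threshold S a) r)"
proof -
  define d where "d = gap S a"
  \<comment> \<open>These are \<open>\<Delta>\<^sub>1 + D\<close> and
    \<open>\<Delta>\<^sub>2 + D\<close> of the threshold, so \<open>u + v - d\<close> is the width
    of \<open>S\<close>.\<close>
  define u where "u = srv S a - srv S 1 + d"
  define v where "v = srv S (card S) - srv S (a + 1) + d"
  define x where "x = v / (u + v) * d"
  have d: "0 < d"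
    using srv_less[OF assms(3,4), of "a + 1"] assms(5) by (simp add: d_def gap_def)
  have uv: "d \<le> u" "d \<le> v"
    using srv_le[OF assms(3), of 1 a] srv_le[OF assms(3), of "a + 1" "card S"] assms
    by (auto simp: u_def v_def)
  have \<alpha>: "u + v - d \<le> \<alpha> * d"
    using assms(8) by (simp add: u_def v_def d_def gap_def)
  have "u / (u + v) + v / (u + v) = 1"
    using d uv by (simp flip: add_divide_distrib)
  then have x': "u / (u + v) * d = d - x"
    unfolding x_def by (metis add_diff_cancel_right' distrib_right mult_1)
  have "v - x \<le> \<alpha> * x"
    using threshold_balance[OF d uv \<alpha>] by (simp add: x_def)
  moreover have "u - u / (u + v) * d \<le> \<alpha> * (u / (u + v) * d)"
    using threshold_balance[of d v u \<alpha>] d uv \<alpha> by (simp add: add.commute)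
  then have "u - (d - x) \<le> \<alpha> * (d - x)"
    unfolding x' .
  moreover have "0 \<le> v / (u + v) * d" "0 \<le> u / (u + v) * d"
    using d uv by auto
  then have "0 \<le> x" "0 \<le> d - x"
    unfolding x' x_def by simp_all
  moreover have "threshold S a = srv S a + x"
    by (simp add: threshold_def Let_def x_def u_def v_def d_def)
  moreover have "lo l = srv S 1" "hi l = srv S a" "lo r = srv S a + d" "hi r = srv S a + v"
    using lo_srv[OF assms(1,6,3)] lo_srv[OF assms(2,7,3)] assms(4,5)
    by (auto simp: d_def v_def gap_def)
  ultimately show ?thesis
    using assms(1,2) d by (simp add: u_def algebra_simps)
qed

text \<open>The bound is assumed for all subsets so that it passes to both parts of a cut; this is
  why \<open>alpha\<close> maximises over subsets.\<close>

lemma ptcp_tree: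
  assumes ix: "max_gap_choice ix" and "finite S" "S \<noteq> {}"
    and "\<And>T. T \<subseteq> S \<Longrightarrow> stretch T \<le> \<alpha>"
  shows "\<exists>t. good \<alpha> t \<and> els t = S \<and>
    (\<forall>q F. F \<subseteq> S \<longrightarrow> F \<noteq> {} \<longrightarrow> chosen t q F (ptcp ix S q F))"
  using assms(2-)
proof (induction "card S" arbitrary: S rule: less_induct)
  case less
  show ?case
  proof (cases "card S = 1")
    case True
    then obtain s where s: "S = {s}"
      by (auto simp: card_1_singleton_iff)
    have "chosen (Leaf s) q F (ptcp ix S q F)" if "F \<subseteq> S" "F \<noteq> {}" for q F
      using ptcp_in[OF ix less.prems(1) that] that s by auto
    then show ?thesis
      using s by (intro exI[of _ "Leaf s"]) auto
  next
    case False
    moreover have "card S \<noteq> 0"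
      using less.prems by auto
    ultimately have card: "2 \<le> card S"
      by linarith
    define a where "a = ix S"
    define A where "A = srv S ` {1..a}"
    define B where "B = srv S ` {a + 1..card S}"
    have "a \<in> {1..card S - 1}" and gap: "gap S a = max_gap S"
      using ix less.prems(1) card unfolding max_gap_choice_def a_def by auto
    then have a: "1 \<le> a" "a < card S"
      using card by auto
    have "{1..a} \<union> {a + 1..card S} = {1..card S}"
      using a by auto
    then have AB: "A \<union> B = S"
      using srv_image[OF less.prems(1)] unfolding A_def B_def image_Un[symmetric] by simp
    have fin: "finite A" "finite B" and ne: "A \<noteq> {}" "B \<noteq> {}"
      using a by (auto simp: A_def B_def)
    have "card A \<le> a" "card B \<le> card S - a"
      using card_image_le[of "{1..a}" "srv S"] card_image_le[of "{a + 1..card S}" "srv S"]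
      by (auto simp: A_def B_def)
    then have lt: "card A < card S" "card B < card S"
      using a by auto
    have "A \<subseteq> S" "B \<subseteq> S"
      using AB by auto
    then have stretch: "T \<subseteq> A \<Longrightarrow> stretch T \<le> \<alpha>" "T \<subseteq> B \<Longrightarrow> stretch T \<le> \<alpha>" for T
      using less.prems(3) by blast+
    obtain l where l: "good \<alpha> l" "els l = A"
      "\<And>q F. F \<subseteq> A \<Longrightarrow> F \<noteq> {} \<Longrightarrow> chosen l q F (ptcp ix A q F)"
      using less.hyps[OF lt(1) fin(1) ne(1) stretch(1)] by blast
    obtain r where r: "good \<alpha> r" "els r = B"
      "\<And>q F. F \<subseteq> B \<Longrightarrow> F \<noteq> {} \<Longrightarrow> chosen r q F (ptcp ix B q F)"
      using less.hyps[OF lt(2) fin(2) ne(2) stretch(2)] by blast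
    have "0 < gap S a"
      using srv_less[OF less.prems(1) a(1), of "a + 1"] a(2) by (simp add: gap_def)
    \<comment> \<open>The cut is at a largest gap, so its length is the denominator of
      \<open>stretch S\<close>.\<close>
    then have "srv S (card S) - srv S 1 \<le> \<alpha> * gap S a"
      using less.prems(3)[of S] card gap by (simp add: stretch_def pos_divide_le_eq)
    then have good: "good \<alpha> (Cut l (threshold S a) r)"
      using good_Cut[OF l(1) r(1) less.prems(1) a] l(2) r(2) by (simp add: A_def B_def)
    have "chosen (Cut l (threshold S a) r) q F (ptcp ix S q F)" if F: "F \<subseteq> S" "F \<noteq> {}" for q F
    proof (cases "is_singleton F")
      case True
      then obtain s where s: "F = {s}"
        by (auto simp: is_singleton_def)
      then have "ptcp ix S q F = s"
        using ptcp_in[OF ix less.prems(1) F] by auto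
      moreover have "s \<in> els (Cut l (threshold S a) r)"
        using s F AB l(2) r(2) by auto
      ultimately show ?thesis
        using chosen_singleton[OF _ good] s by metis
    next
      case False
      have eq: "ptcp ix S q F =
          (if (q \<le> threshold S a \<and> F \<inter> A \<noteq> {}) \<or> F \<inter> B = {}
           then ptcp ix A q (F \<inter> A) else ptcp ix B q (F \<inter> B))"
        using False by (subst ptcp.simps) (simp only: Let_def a_def A_def B_def if_False)
      show ?thesis
      proof (cases "(q \<le> threshold S a \<and> F \<inter> A \<noteq> {}) \<or> F \<inter> B = {}")
        case True
        then have "F \<inter> A \<noteq> {}"
          using F AB by auto
        then have "chosen l q F (ptcp ix S q F)"
          using l(3)[of "F \<inter> A" q] chosen_Int[of l A q F] l(2) eq True by simp
        then show ?thesis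
          using True r(2) by auto
      next
        case neither: False
        then have "chosen r q F (ptcp ix S q F)"
          using r(3)[of "F \<inter> B" q] chosen_Int[of r B q F] r(2) eq by auto
        then show ?thesis
          using neither l(2) by auto
      qed
    qed
    then show ?thesis
      using good AB l(2) r(2) by (intro exI[of _ "Cut l (threshold S a) r"]) auto
  qed
qed

theorem theorem2:
  fixes S :: "real set" and c :: "real \<Rightarrow> nat" and ix :: "real set \<Rightarrow> nat"
  assumes "finite S" and "S \<noteq> {}"
    and "\<forall>s\<in>S. c s \<ge> 1"
    and "max_gap_choice ix"
  shows "competitive S c (ptcp_alg ix S c) (2 * alpha S + 1)"
  unfolding competitive_def
proof (intro allI impI)
  fix \<sigma> :: "real list"
  assume len: "length \<sigma> \<le> (\<Sum>s\<in>S. c s)"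
  have alpha: "stretch T \<le> alpha S" if "T \<subseteq> S" for T
    unfolding alpha_def using assms(1) that by (intro Max_ge) auto
  have alpha_nonneg: "0 \<le> alpha S"
    using alpha[of "{}"] by (simp add: stretch_def)
  obtain t where t: "good (alpha S) t" "els t = S"
    and choice: "\<And>q F. F \<subseteq> S \<Longrightarrow> F \<noteq> {} \<Longrightarrow> chosen t q F (ptcp ix S q F)"
    using ptcp_tree[OF assms(4,1,2) alpha] by blast
  have "opt S c \<sigma> \<in> (\<lambda>ts. match_cost (zip \<sigma> ts)) ` assignments S c \<sigma>"
    unfolding opt_def using finite_assignments[OF assms(1)] assignments_nonempty[OF assms(1) len]
    by (intro Min_in) auto
  \<comment> \<open>An assignment attaining the minimum serves as the reference.\<close>
  then obtain ts where ts: "length ts = length \<sigma>" "set ts \<subseteq> S" "\<forall>s\<in>S. count_list ts s \<le> c s"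
    and opt: "opt S c \<sigma> = match_cost (zip \<sigma> ts)"
    by (auto simp: assignments_def)
  have "tracked t (free (els t) c []) (mset (map snd [])) {#} 0"
    unfolding tracked_def by (intro exI[of _ "{#}"]) auto
  moreover have "chosen t q (free (els t) c h) (ptcp_alg ix S c h q)"
    if "free (els t) c h \<noteq> {}" for h q
    unfolding ptcp_alg_def using choice[of "free S c h" q] that t(2) by (auto simp: free_def)
  ultimately have "match_cost (run (ptcp_alg ix S c) [] \<sigma>)
      \<le> match_cost [] + 0 + (2 * alpha S + 1) * match_cost (zip \<sigma> ts)"
    using run_cost_le[OF alpha_nonneg t(1), of c "ptcp_alg ix S c" \<sigma> ts "{#}" "[]" 0] ts t(2) by simp
  then show "alg_cost (ptcp_alg ix S c) \<sigma> \<le> (2 * alpha S + 1) * opt S c \<sigma>"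
    by (simp add: alg_cost_def opt match_cost_def)
qed

end
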